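(* Let $k\ge3$ be odd and $n\ge0$ an integer. For every prime power $q\equiv 2k+1\pmod{4k}$ with $q>8k^5n$, there exists an $(\mathbb F_q^\Box,k;n)$ Heffter difference packing $\{B_1,\dots,B_n\}$ in which every $B_i$ admits an ordering $(b_0,\dots,b_{k-1})$ whose partial sums $b_0, b_0+b_1,\dots,b_0+\dots+b_{k-1}$ are pairwise distinct.
   Context: Here $v=\frac{q-1}{2}$ (odd, since $q\equiv3\pmod4$). $\mathbb F_q^\Box$ denotes the multiplicative group of nonzero squares of $\mathbb F_q$. Fix a group isomorphism $\phi:\mathbb F_q^\Box\to\mathbb Z_v$. An $(\mathbb F_q^\Box,k;n)$ Heffter difference packing is a family of $n$ $k$-subsets $B_1,\dots,B_n$ of $\mathbb F_q^\Box$ such that: the multiset of all differences $a-b$, with $(a,b)$ an ordered pair of distinct elements of a common $\phi(B_i)$, over all $i$, has no repeated element of $\mathbb Z_v$; $k$ divides $v$ and the elements of each $\phi(B_i)$ are pairwise distinct modulo $k$; each $B_i$ sums to $0$ in $\mathbb F_q$. For $n=0$ the empty family counts. *)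

theory Defs
  imports "HOL-Number_Theory.Number_Theory"
begin

definition nz_squares :: "'a::field set" where
  "nz_squares = {x ^ 2 | x. x \<noteq> 0}"

definition sq_iso :: "('a::field \<Rightarrow> nat) \<Rightarrow> nat \<Rightarrow> bool" where
  "sq_iso \<phi> v \<longleftrightarrow> bij_betw \<phi> nz_squares {0..<v} \<and>
     (\<forall>x\<in>nz_squares. \<forall>y\<in>nz_squares. \<phi> (x * y) = (\<phi> x + \<phi> y) mod v)"

definition heffter_dp ::
  "('a::field \<Rightarrow> nat) \<Rightarrow> nat \<Rightarrow> nat \<Rightarrow> nat \<Rightarrow> (nat \<Rightarrow> 'a set) \<Rightarrow> bool" where
  "heffter_dp \<phi> v k n B \<longleftrightarrow>
     (\<forall>i<n. B i \<subseteq> nz_squares \<and> finite (B i) \<and> card (B i) = k) \<and>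
     inj_on (\<lambda>(i, a, b). (int a - int b) mod int v)
       {(i, a, b). i < n \<and> a \<in> \<phi> ` B i \<and> b \<in> \<phi> ` B i \<and> a \<noteq> b} \<and>
     k dvd v \<and>
     (\<forall>i<n. \<forall>a\<in>\<phi> ` B i. \<forall>b\<in>\<phi> ` B i. a \<noteq> b \<longrightarrow> a mod k \<noteq> b mod k) \<and>
     (\<forall>i<n. (\<Sum>x\<in>B i. x) = 0)"

definition distinct_partial_sums_ordering :: "'a::comm_monoid_add set \<Rightarrow> bool" where
  "distinct_partial_sums_ordering S \<longleftrightarrow>
     (\<exists>bs. distinct bs \<and> set bs = S \<and>
        distinct (map (\<lambda>j. sum_list (take (Suc j) bs)) [0..<length bs]))"

end

theory Submission
  imports Defs Complex_Main
begin

text \<open>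
  Write \<open>v = k w\<close> and let \<open>C j\<close> be the set of nonzero squares whose image under \<open>\<phi>\<close> is \<open>j\<close>
  modulo \<open>k\<close>, a coset of size \<open>w\<close>. Each block is a transversal \<open>c\<^sub>0, \<dots>, c\<^sub>k\<^sub>-\<^sub>1\<close> of these cosets; the
  difference condition says that quotients of block elements never repeat. All but the last two
  elements of a block are chosen greedily. The last two, \<open>x\<close> and \<open>s - x\<close>, must lie in two given
  cosets; a variance estimate for incidences between points and lines shows that at least
  \<open>w\<^sup>2/q - \<surd>q\<close> values of \<open>x\<close> qualify, and when \<open>q > 8k\<^sup>5n\<close> this exceeds the number of values that
  produce a repeated quotient or a repeated partial sum. The margin is thin for \<open>k = 3\<close>, so
  the count of forbidden values uses that an equation \<open>c\<^sub>a c\<^sub>b = c\<^sub>d c\<^sub>e\<close> forces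
  \<open>a + b \<equiv> d + e\<close> modulo \<open>k\<close>, and that squaring is injective on the squares.
\<close>

section \<open>Counting in finite fields\<close>

lemma card_quadratic_roots_le:
  fixes b c :: "'a::{field, finite}"
  shows "card {x. x^2 + b * x + c = 0} \<le> 2"
proof (cases "{x. x^2 + b * x + c = 0} = {}")
  case True
  then show ?thesis by simp
next
  case False
  then obtain y where y: "y^2 + b * y + c = 0" by blast
  have "x = y \<or> x = - b - y" if "x^2 + b * x + c = 0" for x
  proof -
    have "(x - y) * (x + y + b) = (x^2 + b * x + c) - (y^2 + b * y + c)"
      by (simp add: algebra_simps power2_eq_square)
    then have "x - y = 0 \<or> x + y + b = 0" using that y by simp
    then show ?thesis by (auto simp: algebra_simps eq_neg_iff_add_eq_0)
  qed
  then have "{x. x^2 + b * x + c = 0} \<subseteq> {y, - b - y}" by blast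
  then have "card {x. x^2 + b * x + c = 0} \<le> card {y, - b - y}"
    by (intro card_mono) auto
  also have "\<dots> \<le> 2" by (simp add: card_insert_if)
  finally show ?thesis .
qed

text \<open>\<open>r z d\<close> counts the points of \<open>A \<times> B\<close> on the line y = d
  - z x. Two points with different abscissas lie on at most one such line, so over all
  \<open>(z, d)\<close> the incidence indicators for different \<open>x\<close> have covariance at
  most 0. The variance of the count is then bounded by the sum of the variances for single
  \<open>x\<close>.\<close>

lemma incidence_variance:
  fixes A B :: "'a::{field, finite} set"
  defines "r \<equiv> \<lambda>z d. real (card {x \<in> A. d - z * x \<in> B})"
    and "q \<equiv> real (card (UNIV :: 'a set))"
    and "a \<equiv> real (card A)" and "b \<equiv> real (card B)"
  shows "(\<Sum>(z, d)\<in>UNIV. (r z d - a * b / q)^2) \<le> q * a * b"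
proof -
  define P where "P = (\<lambda>x z d. of_bool (d - z * x \<in> B) :: real)"
  have q: "q > 0" unfolding q_def by (simp add: card_gt_0_iff)
  have r: "r z d = (\<Sum>x\<in>A. P x z d)" for z d
    unfolding r_def P_def of_bool_def by (subst sum.inter_filter[symmetric]) simp_all
  have P1: "(\<Sum>(z, d)\<in>UNIV. P x z d) = q * b" for x
  proof -
    have "(\<Sum>d\<in>UNIV. P x z d) = b" for z
    proof -
      have "(\<Sum>d\<in>UNIV. P x z d) = (\<Sum>d\<in>UNIV. of_bool (d \<in> B))"
        unfolding P_def
        by (rule sum.reindex_bij_witness[of _ "\<lambda>d. d + z * x" "\<lambda>d. d - z * x"]) auto
      then show ?thesis by (simp add: b_def of_bool_def sum.If_cases)
    qed
    then show ?thesis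
      by (simp add: UNIV_Times_UNIV[symmetric] sum.cartesian_product[symmetric] q_def
          del: UNIV_Times_UNIV)
  qed
  have PP: "(\<Sum>(z, d)\<in>UNIV. P x z d * P y z d) \<le> (if x = y then q * b else b * b)" for x y
  proof (cases "x = y")
    case True
    then have *: "P x z d * P y z d = P x z d" for z d by (simp add: P_def)
    show ?thesis using P1[of x] True unfolding * by simp
  next
    case False
    let ?f = "\<lambda>(z, d). (d - z * x, d - z * y)"
    let ?S = "{(z, d). d - z * x \<in> B \<and> d - z * y \<in> B}"
    have "inj ?f"
    proof (rule injI, clarify)
      fix z d z' d' assume e: "d - z * x = d' - z' * x" "d - z * y = d' - z' * y"
      have "(z - z') * (x - y) = (d' - z' * x - (d - z * x)) - (d' - z' * y - (d - z * y))"
        by (simp add: algebra_simps)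
      then have "(z - z') * (x - y) = 0" using e by simp
      then have "z = z'" using False by simp
      then show "z = z' \<and> d = d'" using e by simp
    qed
    then have "inj_on ?f ?S" by (rule inj_on_subset) simp
    moreover have "?f ` ?S \<subseteq> B \<times> B" by auto
    ultimately have "card ?S \<le> card (B \<times> B)" by (intro card_inj_on_le) auto
    then have *: "real (card ?S) \<le> b * b"
      unfolding b_def card_cartesian_product of_nat_mult[symmetric] of_nat_le_iff .
    have "(\<Sum>(z, d)\<in>UNIV. P x z d * P y z d) = (\<Sum>p\<in>UNIV. of_bool (p \<in> ?S))"
      by (intro sum.cong) (auto simp: P_def)
    also have "\<dots> = card ?S" by (simp add: of_bool_def sum.If_cases)
    finally show ?thesis using * False by simp
  qed
  have s1: "(\<Sum>(z, d)\<in>UNIV. r z d) = q * a * b"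
  proof -
    have "(\<Sum>(z, d)\<in>UNIV. r z d) = (\<Sum>x\<in>A. \<Sum>(z, d)\<in>UNIV. P x z d)"
      unfolding r split_def by (rule sum.swap)
    then show ?thesis by (simp add: P1 a_def)
  qed
  have "(\<Sum>(z, d)\<in>UNIV. (r z d)^2) = (\<Sum>p\<in>UNIV. \<Sum>x\<in>A. \<Sum>y\<in>A. P x (fst p) (snd p) * P y (fst p) (snd p))"
    by (simp add: r split_def power2_eq_square sum_product)
  also have "\<dots> = (\<Sum>x\<in>A. \<Sum>y\<in>A. \<Sum>(z, d)\<in>UNIV. P x z d * P y z d)"
    unfolding split_def by (subst sum.swap, intro sum.cong refl, subst sum.swap) simp
  also have "\<dots> \<le> (\<Sum>x\<in>A. \<Sum>y\<in>A. if x = y then q * b else b * b)"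
    by (intro sum_mono PP)
  also have "\<dots> \<le> (\<Sum>x\<in>A. \<Sum>y\<in>A. (if x = y then q * b else 0) + b * b)"
    by (intro sum_mono) auto
  also have "\<dots> = q * a * b + a * a * b * b"
    by (simp add: sum.distrib a_def algebra_simps)
  finally have s2: "(\<Sum>(z, d)\<in>UNIV. (r z d)^2) \<le> q * a * b + a * a * b * b" .
  have "(\<Sum>(z, d)\<in>UNIV. (r z d - a * b / q)^2)
      = (\<Sum>(z, d)\<in>UNIV. (r z d)^2) - 2 * (a * b / q) * (\<Sum>(z, d)\<in>UNIV. r z d)
        + (\<Sum>p\<in>(UNIV :: ('a \<times> 'a) set). (a * b / q)^2)"
    unfolding sum_distrib_left sum_subtractf[symmetric] sum.distrib[symmetric]
    by (intro sum.cong refl) (simp add: split_def power2_eq_square algebra_simps)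
  also have "(\<Sum>p\<in>(UNIV :: ('a \<times> 'a) set). (a * b / q)^2) = a * a * b * b"
    using q by (simp add: q_def UNIV_Times_UNIV[symmetric] card_cartesian_product
        power2_eq_square del: UNIV_Times_UNIV)
  also have "2 * (a * b / q) * (\<Sum>(z, d)\<in>UNIV. r z d) = 2 * (a * a * b * b)"
    using q by (simp add: s1)
  finally show ?thesis using s2 by linarith
qed

lemma index_from_mod_sum:
  fixes a b d e k :: nat
  assumes "(a + b) mod k = (d + e) mod k" "d < k" "e < k"
  shows "e = (a + b + k - d) mod k"
proof -
  have "[a + b + (k - d) = d + e + (k - d)] (mod k)"
    using cong_add[OF assms(1)[folded cong_def] cong_refl] .
  also have "d + e + (k - d) = e + k" using assms by simp
  finally show ?thesis using assms by (simp add: cong_def)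
qed

lemma card_le_one:
  fixes S :: "'a::finite set"
  assumes "\<And>x y. x \<in> S \<Longrightarrow> y \<in> S \<Longrightarrow> x = y"
  shows "card S \<le> 1"
  using assms by (simp add: card_le_Suc0_iff_eq)

lemma card_scaled_UN_le:
  fixes f :: "'i \<Rightarrow> 'a::finite set"
  assumes "finite I" "\<And>i. i \<in> I \<Longrightarrow> card (f i) \<le> M"
  shows "card (\<Union>i\<in>I. f i) \<le> card I * M"
proof -
  have "card (\<Union>i\<in>I. f i) \<le> (\<Sum>i\<in>I. card (f i))" using assms by (intro card_UN_le)
  also have "\<dots> \<le> card I * M" using assms sum_bounded_above[of I "\<lambda>i. card (f i)" M] by simp
  finally show ?thesis .
qed

section \<open>The numerical margin behind q > 8 k^5 n\<close>

text \<open>The bound \<open>n * k * (2 * k - 3)\<close> is the budget for forbidden choices when a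
  block is closed. If \<open>N\<close> did not exceed it, then \<open>N\<close> would be at most q
  (2k - 3) / (8 k^4), too far below the mean w^2 / q, about q / (4 k^2), for a deviation of at most
  the square root of q.\<close>

lemma representation_count_bound:
  fixes k n q w N :: real
  assumes k: "k \<ge> 3" and n: "n \<ge> 1" and q: "q > 8 * k^5 * n" and w: "q = 2 * k * w + 1"
    and dev: "(N - w^2 / q)^2 \<le> q"
  shows "N > n * k * (2 * k - 3)"
proof (rule ccontr)
  assume "\<not> ?thesis"
  then have N: "N \<le> n * k * (2 * k - 3)" by simp
  \<comment> \<open>After scaling by \<open>8 * k^4\<close> the mean is about
    \<open>2 * k^2 * q\<close> and \<open>N\<close> becomes at most \<open>q * (2 * k - 3)\<close>;
    \<open>m\<close> is the difference of the two coefficients of \<open>q\<close>.\<close>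
  define m where "m = 2 * k^2 - 2 * k + 3"
  have k0: "k > 0" using k by simp
  have "8 * k^5 * 1 \<le> 8 * k^5 * n" using n k0 by (intro mult_left_mono) auto
  then have q8: "q > 8 * k^5" using q by simp
  then have q0: "q > 0" using k0 by (smt (verit) zero_less_power)
  have N8: "8 * k^4 * N \<le> q * (2 * k - 3)"
  proof -
    have "8 * k^4 * N \<le> 8 * k^4 * (n * k * (2 * k - 3))"
      using N k0 by (intro mult_left_mono) auto
    also have "\<dots> = (8 * k^5 * n) * (2 * k - 3)" by (simp add: power_numeral_reduce)
    also have "\<dots> \<le> q * (2 * k - 3)" using q k by (intro mult_right_mono) auto
    finally show ?thesis .
  qed
  have "8 * k^4 * w^2 = 2 * k^2 * (2 * k * w)^2" by (simp add: power_numeral_reduce)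
  also have "2 * k * w = q - 1" using w by simp
  also have "2 * k^2 * (q - 1)^2 \<ge> q * (2 * k^2 * q - 4 * k^2)"
    using k0 by (simp add: power2_eq_square algebra_simps)
  finally have "8 * k^4 * (w^2 / q) \<ge> 2 * k^2 * q - 4 * k^2"
    using q0 by (simp add: pos_le_divide_eq mult.commute)
  then have D: "8 * k^4 * (w^2 / q - N) \<ge> q * m - 4 * k^2"
    using N8 by (simp add: m_def algebra_simps)
  have k2: "k^2 \<ge> 3 * k" using k by (simp add: power2_eq_square)
  have k39: "k^3 \<ge> 9 * k"
    using mult_mono[OF k k2] k by (simp add: power_numeral_reduce)
  have m1: "m \<ge> 15" using k k2 unfolding m_def by linarith
  have "k * k^3 \<ge> 3 * k^3" using k by (intro mult_right_mono) auto
  \<comment> \<open>At \<open>q = 8 * k^5\<close> the leading terms of the desired contradiction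
    compare exactly \<open>m^2\<close> with \<open>8 * k^3\<close>; the margin 9 is attained at k =
    3.\<close>
  have mm: "m^2 - 8 * k^3 \<ge> 9"
  proof -
    have "k * (k - 2)^2 \<ge> 3 * 1"
      using k by (intro mult_mono) (auto simp: one_le_power)
    then have "4 * k * (k * (k - 2)^2) \<ge> 4 * k * 3" using k0 by (intro mult_left_mono) auto
    moreover have "m^2 - 8 * k^3 = 4 * k * (k * (k - 2)^2) - 12 * k + 9"
      unfolding m_def by (simp add: power_numeral_reduce algebra_simps)
    ultimately show ?thesis by linarith
  qed
  have "k^3 * 9 \<le> k^3 * (m^2 - 8 * k^3)" using mm k0 by (intro mult_left_mono) auto
  moreover have "k^3 * 9 > m"
  proof -
    have "k^3 \<ge> 3 * k^2" using k by (simp add: power_numeral_reduce)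
    then show ?thesis using k k2 unfolding m_def by linarith
  qed
  \<comment> \<open>This is \<open>q * m^2 - 8 * k^2 * m > 64 * k^8\<close> at
    \<open>q = 8 * k^5\<close>, divided by \<open>8 * k^2\<close>.\<close>
  ultimately have "k^3 * (m^2 - 8 * k^3) - m > 0" by linarith
  then have "8 * k^2 * (k^3 * (m^2 - 8 * k^3) - m) > 0" using k0 by simp
  then have key: "8 * k^5 * m^2 - 8 * k^2 * m > 64 * k^8"
    by (simp add: power_numeral_reduce algebra_simps)
  have "q * m^2 \<ge> 8 * k^5 * m^2" using q8 by (intro mult_right_mono) auto
  then have "q * m^2 - 8 * k^2 * m > 64 * k^8" using key by linarith
  then have "q * (q * m^2 - 8 * k^2 * m) > q * (64 * k^8)" using q0 by simp
  moreover have "(q * m - 4 * k^2)^2 = q * (q * m^2 - 8 * k^2 * m) + 16 * k^4"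
    by (simp add: power_numeral_reduce algebra_simps)
  moreover have "(q * m - 4 * k^2)^2 \<le> (8 * k^4 * (w^2 / q - N))^2"
  proof (rule power_mono[OF D])
    have "q * 1 \<le> q * m" using q0 m1 by (intro mult_left_mono) auto
    moreover have "4 * k^2 \<le> 8 * k^5"
    proof -
      have "k^2 * 1 \<le> k^2 * k^3" using k by (intro mult_left_mono) (auto simp: one_le_power)
      moreover have "k^2 * k^3 = k^5" by (simp add: power_numeral_reduce)
      ultimately show ?thesis using k0 by (smt (verit) zero_less_power)
    qed
    ultimately show "0 \<le> q * m - 4 * k^2" using q8 by linarith
  qed
  moreover have "(8 * k^4 * (w^2 / q - N))^2 = 64 * k^8 * (N - w^2 / q)^2"
    by (simp add: power_mult_distrib power2_commute flip: power_mult)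
  moreover have "64 * k^8 * (N - w^2 / q)^2 \<le> 64 * k^8 * q"
    using dev k0 by (intro mult_left_mono) auto
  moreover have "16 * k^4 \<ge> 0" by simp
  moreover have "q * (64 * k^8) = 64 * k^8 * q" by simp
  ultimately show False by linarith
qed

section \<open>Cosets of the squares\<close>

locale square_cosets =
  fixes \<phi> :: "'a::{field, finite} \<Rightarrow> nat" and k w :: nat
  assumes iso: "sq_iso \<phi> (k * w)"
    and k3: "k \<ge> 3"
    and odd_kw: "odd (k * w)"
begin

text \<open>For \<open>j \<ge> k\<close> the set is empty, which is why the cardinality
  \<open>w\<close> requires \<open>j < k\<close>.\<close>

definition C :: "nat \<Rightarrow> 'a set" where
  "C j = {x \<in> nz_squares. \<phi> x mod k = j}"

lemma w_pos: "w > 0"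
  using odd_kw by (cases w) auto

lemma nz_squares_nonzero: "x \<in> nz_squares \<Longrightarrow> x \<noteq> (0 :: 'a)"
  by (auto simp: nz_squares_def)

lemma nz_squares_mult: "x \<in> nz_squares \<Longrightarrow> y \<in> nz_squares \<Longrightarrow> x * y \<in> (nz_squares :: 'a set)"
  unfolding nz_squares_def by (auto simp: power_mult_distrib[symmetric])

lemma nz_squares_inverse: "x \<in> nz_squares \<Longrightarrow> inverse x \<in> (nz_squares :: 'a set)"
  unfolding nz_squares_def by (auto simp: power_inverse[symmetric])

lemma phi_mult: "x \<in> nz_squares \<Longrightarrow> y \<in> nz_squares \<Longrightarrow> \<phi> (x * y) = (\<phi> x + \<phi> y) mod (k * w)"
  using iso by (auto simp: sq_iso_def)

lemma phi_less: "x \<in> nz_squares \<Longrightarrow> \<phi> x < k * w"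
  using iso by (auto simp: sq_iso_def bij_betw_def)

lemma phi_inj: "x \<in> nz_squares \<Longrightarrow> y \<in> nz_squares \<Longrightarrow> \<phi> x = \<phi> y \<Longrightarrow> x = y"
  using iso by (auto simp: sq_iso_def bij_betw_def inj_on_def)

lemma C_nz: "x \<in> C j \<Longrightarrow> x \<in> nz_squares" by (simp add: C_def)

lemma C_nonzero: "x \<in> C j \<Longrightarrow> x \<noteq> 0" using C_nz nz_squares_nonzero by blast

lemma C_unique: "x \<in> C i \<Longrightarrow> x \<in> C j \<Longrightarrow> i = j" by (simp add: C_def)

lemma C_mult: "x \<in> C i \<Longrightarrow> y \<in> C j \<Longrightarrow> x * y \<in> C ((i + j) mod k)"
  by (auto simp: C_def nz_squares_mult phi_mult mod_mod_cancel mod_add_eq)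

lemma C_class:
  "a \<in> C i \<Longrightarrow> b \<in> C j \<Longrightarrow> c \<in> C i' \<Longrightarrow> d \<in> C j' \<Longrightarrow> a * b = c * d \<Longrightarrow> (i + j) mod k = (i' + j') mod k"
  using C_mult C_unique by metis

text \<open>Three factors of a product equation fix the coset, and hence the index, of the fourth.
  Forbidden products are therefore counted over pairs of indices instead of triples.\<close>

lemma C_class_index:
  assumes "a \<in> C i" "b \<in> C j" "c \<in> C i'" "d \<in> C j'" "a * b = c * d" "i' < k" "j' < k"
  shows "j' = (i + j + k - i') mod k"
  using assms C_class[OF assms(1-5)] index_from_mod_sum by blast

text \<open>The group of squares has odd order, so doubling is invertible modulo
  \<open>k * w\<close>. An equation prescribing \<open>x^2\<close> thus excludes at most one square
  \<open>x\<close> instead of two.\<close>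

lemma square_inj_on_nz_squares: "inj_on (\<lambda>x. x^2) (nz_squares :: 'a set)"
proof (rule inj_onI)
  fix x y :: 'a assume *: "x \<in> nz_squares" "y \<in> nz_squares" "x^2 = y^2"
  then have "[\<phi> x + \<phi> x = \<phi> y + \<phi> y] (mod k * w)"
    using phi_mult[of x x] phi_mult[of y y] by (simp add: power2_eq_square cong_def)
  then have "[2 * \<phi> x = 2 * \<phi> y] (mod k * w)" by (simp add: mult_2)
  moreover have "coprime 2 (k * w)" using odd_kw by simp
  ultimately have "[\<phi> x = \<phi> y] (mod k * w)" by (metis cong_mult_lcancel_nat)
  then have "\<phi> x = \<phi> y" using phi_less * by (simp add: cong_def)
  then show "x = y" using phi_inj * by blast
qed

text \<open>\<open>sq_iso\<close> speaks of products only: \<open>1 * u = u\<close> puts 1 into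
  \<open>C 0\<close>, and then \<open>u * inverse u = 1\<close> determines the class of the
  inverse.\<close>

lemma C0_inverse: "u \<in> C 0 \<Longrightarrow> inverse u \<in> C 0"
proof -
  assume u: "u \<in> C 0"
  define j where "j = \<phi> (inverse u) mod k"
  have i: "inverse u \<in> C j" using u nz_squares_inverse by (auto simp: C_def j_def)
  have "j < k" using k3 by (simp add: j_def)
  have "(1::'a) \<in> nz_squares" unfolding nz_squares_def by (auto intro!: exI[of _ 1])
  then have "1 \<in> C (\<phi> 1 mod k)" by (simp add: C_def)
  from C_mult[OF this u] have "u \<in> C ((\<phi> 1 mod k + 0) mod k)" by simp
  then have "\<phi> 1 mod k = 0" using C_unique[OF u] by simp
  then have one: "1 \<in> C 0" using \<open>1 \<in> C (\<phi> 1 mod k)\<close> by simp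
  from C_mult[OF u i] have "1 \<in> C j" using C_nonzero[OF u] \<open>j < k\<close> by simp
  then show ?thesis using C_unique[OF one] i by metis
qed

lemma C0_act: "u \<in> C 0 \<Longrightarrow> x \<in> C j \<Longrightarrow> j < k \<Longrightarrow> u * x \<in> C j"
  using C_mult[of u 0 x j] by simp

lemma card_C: "j < k \<Longrightarrow> card (C j) = w"
proof -
  assume j: "j < k"
  have "bij_betw \<phi> (C j) {i. i < k * w \<and> i mod k = j}"
    using iso unfolding sq_iso_def C_def bij_betw_def inj_on_def by (auto simp: image_iff)
  then have "card (C j) = card {i. i < k * w \<and> i mod k = j}" by (rule bij_betw_same_card)
  also have "{i. i < k * w \<and> i mod k = j} = (\<lambda>t. k * t + j) ` {..<w}"
  proof (intro equalityI subsetI)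
    fix i assume "i \<in> {i. i < k * w \<and> i mod k = j}"
    then have "i = k * (i div k) + j" "i div k < w"
      by (auto simp: mult_div_mod_eq less_mult_imp_div_less mult.commute)
    then show "i \<in> (\<lambda>t. k * t + j) ` {..<w}" by blast
  next
    fix i assume "i \<in> (\<lambda>t. k * t + j) ` {..<w}"
    then obtain t where t: "t < w" "i = k * t + j" by blast
    then have "k * Suc t \<le> k * w" by (intro mult_le_mono2) simp
    then show "i \<in> {i. i < k * w \<and> i mod k = j}" using t j by simp
  qed
  also have "card \<dots> = w" using k3 by (subst card_image) (auto simp: inj_on_def)
  finally show ?thesis .
qed

text \<open>The count is constant on the \<open>w\<^sup>2\<close> lines with slope in \<open>C 0\<close> and intercept in
  \<open>s \<sqdot> C 0\<close>, so the variance over all lines controls its deviation from the mean.\<close>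

lemma card_sum_representations:
  assumes "i < k" "j < k" "s \<noteq> 0"
  defines "q \<equiv> real (card (UNIV :: 'a set))"
  shows "(real (card {x \<in> C i. s - x \<in> C j}) - (real w)^2 / q)^2 \<le> q"
proof -
  define N where "N = card {x \<in> C i. s - x \<in> C j}"
  define r where "r = (\<lambda>z d. real (card {x \<in> C i. d - z * x \<in> C j}))"
  have const: "r z (u * s) = real N" if z: "z \<in> C 0" and u: "u \<in> C 0" for z u
  proof -
    have nz: "z \<noteq> 0" "u \<noteq> 0" using z u C_nonzero by auto
    \<comment> \<open>\<open>u * s - z * x = u * (s - z * x / u)\<close>, and multiplication by
      \<open>z\<close>, \<open>u\<close> and their inverses, all in \<open>C 0\<close>, preserves
      every coset.\<close>
    have "bij_betw (\<lambda>x. z * x / u) {x \<in> C i. u * s - z * x \<in> C j} {x \<in> C i. s - x \<in> C j}"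
    proof (rule bij_betwI[where g = "\<lambda>x. u * x / z"])
      show "(\<lambda>x. z * x / u) \<in> {x \<in> C i. u * s - z * x \<in> C j} \<rightarrow> {x \<in> C i. s - x \<in> C j}"
      proof clarify
        fix x assume x: "x \<in> C i" "u * s - z * x \<in> C j"
        have "inverse u * (z * x) \<in> C i"
          using x z u assms(1) by (intro C0_act C0_inverse) auto
        moreover have "inverse u * (u * s - z * x) \<in> C j"
          using x u assms(2) by (intro C0_act C0_inverse) auto
        moreover have "inverse u * (u * s - z * x) = s - z * x / u"
          using nz by (simp add: field_simps)
        ultimately show "z * x / u \<in> C i \<and> s - z * x / u \<in> C j"
          by (metis divide_inverse mult.commute)
      qed
      show "(\<lambda>x. u * x / z) \<in> {x \<in> C i. s - x \<in> C j} \<rightarrow> {x \<in> C i. u * s - z * x \<in> C j}"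
      proof clarify
        fix x assume x: "x \<in> C i" "s - x \<in> C j"
        have "inverse z * (u * x) \<in> C i"
          using x z u assms(1) by (intro C0_act C0_inverse) auto
        moreover have "u * (s - x) \<in> C j"
          using x u assms(2) by (intro C0_act) auto
        moreover have "u * (s - x) = u * s - z * (u * x / z)"
          using nz by (simp add: field_simps)
        ultimately show "u * x / z \<in> C i \<and> u * s - z * (u * x / z) \<in> C j"
          by (metis divide_inverse mult.commute)
      qed
    qed (use nz in auto)
    then show ?thesis unfolding r_def N_def using bij_betw_same_card by fastforce
  qed
  let ?L = "(\<lambda>(z, u). (z, u * s)) ` (C 0 \<times> C 0)"
  have c0: "card (C 0) = w" using card_C k3 by simp
  \<comment> \<open>\<open>s \<noteq> 0\<close> keeps the intercepts \<open>u * s\<close> distinct,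
    so there are \<open>w * w\<close> lines with equal squared deviation. The variance bound
    \<open>q * w * w\<close> divided by their number leaves \<open>q\<close>.\<close>
  have "inj_on (\<lambda>(z, u). (z, u * s)) (C 0 \<times> C 0)"
    using assms(3) by (auto simp: inj_on_def)
  then have L: "card ?L = w * w" by (simp add: card_image card_cartesian_product c0)
  have "real (w * w) * (real N - (real w)^2 / q)^2
      = (\<Sum>(z, d)\<in>?L. (r z d - (real w)^2 / q)^2)"
  proof -
    have "(\<Sum>(z, d)\<in>?L. (r z d - (real w)^2 / q)^2) = (\<Sum>p\<in>?L. (real N - (real w)^2 / q)^2)"
      by (intro sum.cong refl) (auto simp: const)
    then show ?thesis by (simp add: L)
  qed
  also have "\<dots> \<le> (\<Sum>(z, d)\<in>UNIV. (r z d - (real w)^2 / q)^2)"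
    by (intro sum_mono2) auto
  also have "\<dots> \<le> real (w * w) * q"
    using incidence_variance[of "C i" "C j"] card_C assms(1,2)
    by (simp add: r_def q_def power2_eq_square mult_ac)
  finally show ?thesis using w_pos unfolding N_def by simp
qed

section \<open>Extending a single block\<close>

text \<open>In applications \<open>R \<delta>\<close> collects the quotients in \<open>C \<delta>\<close> arising from earlier blocks. It is
  closed under inversion up to \<open>\<delta> \<mapsto> k - \<delta>\<close>, so only the pairs \<open>m < l\<close> need to be tested.\<close>

definition admissible :: "(nat \<Rightarrow> 'a set) \<Rightarrow> nat set \<Rightarrow> (nat \<Rightarrow> 'a) \<Rightarrow> bool" where
  "admissible R I c \<longleftrightarrow> (\<forall>i\<in>I. c i \<in> C i) \<and>
     (\<forall>m\<in>I. \<forall>l\<in>I. m < l \<longrightarrow> c l / c m \<notin> R (l - m)) \<and>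
     (\<forall>a\<in>I. \<forall>b\<in>I. \<forall>d\<in>I. \<forall>e\<in>I. c a * c b = c d * c e \<longrightarrow> a = d \<and> b = e \<or> a = e \<and> b = d)"

definition excluded_ratio :: "(nat \<Rightarrow> 'a set) \<Rightarrow> nat set \<Rightarrow> (nat \<Rightarrow> 'a) \<Rightarrow> nat \<Rightarrow> 'a set" where
  "excluded_ratio R I c t = (\<Union>m\<in>I. (\<lambda>r. r * c m) ` R (t - m))"

text \<open>Here \<open>t + b + k - d\<close> modulo \<open>k\<close> is the only index \<open>e\<close> for which \<open>x c\<^sub>b = c\<^sub>d c\<^sub>e\<close> with
  \<open>x\<close> in \<open>C t\<close> is compatible with the cosets; adding \<open>k\<close> avoids truncated subtraction.\<close>

definition excluded_prod :: "nat set \<Rightarrow> (nat \<Rightarrow> 'a) \<Rightarrow> nat \<Rightarrow> 'a set" where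
  "excluded_prod I c t = (\<Union>b\<in>I. (\<lambda>d. c d * c ((t + b + k - d) mod k) / c b) ` (I - {b}))"

text \<open>This is the case where the new element occurs twice on one side. Restricting to squares
  makes \<open>x\<close> determined by \<open>x^2\<close>.\<close>

definition excluded_square :: "nat set \<Rightarrow> (nat \<Rightarrow> 'a) \<Rightarrow> nat \<Rightarrow> 'a set" where
  "excluded_square I c t = {x \<in> nz_squares. x^2 \<in> (\<lambda>d. c d * c ((t + t + k - d) mod k)) ` I}"

definition excluded :: "(nat \<Rightarrow> 'a set) \<Rightarrow> nat set \<Rightarrow> (nat \<Rightarrow> 'a) \<Rightarrow> nat \<Rightarrow> 'a set" where
  "excluded R I c t = excluded_ratio R I c t \<union> excluded_prod I c t \<union> excluded_square I c t"

text \<open>The three terms come from an index \<open>m\<close> with a quotient in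
  \<open>R (t - m)\<close>, from pairs \<open>b \<noteq> d\<close>, and from a single
  \<open>d\<close>, since squaring is injective on the squares.\<close>

lemma card_excluded:
  assumes "finite I" "\<And>\<delta>. card (R \<delta>) \<le> M"
  shows "card (excluded R I c t) \<le> card I * M + card I * (card I - 1) + card I"
proof -
  have "card (excluded_ratio R I c t) \<le> card I * M"
    unfolding excluded_ratio_def using assms
    by (intro card_scaled_UN_le) (auto intro: order_trans[OF card_image_le])
  moreover have "card (excluded_prod I c t) \<le> card I * (card I - 1)"
    unfolding excluded_prod_def using assms(1)
    by (intro card_scaled_UN_le order_trans[OF card_image_le]) auto
  moreover have "card (excluded_square I c t) \<le> card ((\<lambda>d. c d * c ((t + t + k - d) mod k)) ` I)"
    unfolding excluded_square_def using assms(1)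
    by (intro card_inj_on_le[of "\<lambda>x. x^2"] inj_on_subset[OF square_inj_on_nz_squares]) auto
  moreover have "\<dots> \<le> card I" using assms(1) by (rule card_image_le)
  moreover have "card (excluded R I c t) \<le> card (excluded_ratio R I c t) + card (excluded_prod I c t) + card (excluded_square I c t)"
    unfolding excluded_def by (meson add_mono_thms_linordered_semiring(3) card_Un_le order_trans)
  ultimately show ?thesis by linarith
qed

text \<open>An index occurring on both sides of a product equation cancels, and the remaining
  factors are equal, hence have the same index because the cosets are disjoint. In an equation
  without a shared index, \<open>t\<close> can occur on one side only.\<close>

lemma admissible_insert:
  assumes admissible: "admissible R I c" and x: "x \<in> C t" and t: "t < k" and I: "\<And>i. i \<in> I \<Longrightarrow> i < t"
    and nb: "x \<notin> excluded R I c t"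
  shows "admissible R (insert t I) (c(t := x))"
proof -
  define c' where "c' = c(t := x)"
  have tI: "t \<notin> I" using I by blast
  have c't: "c' t = x" and c'I: "\<And>i. i \<in> I \<Longrightarrow> c' i = c i"
    using tI by (auto simp: c'_def)
  have C': "c' i \<in> C i" if "i \<in> insert t I" for i
    using that admissible x c'I by (auto simp: c't admissible_def)
  have lt: "i < k" if "i \<in> insert t I" for i using that I t by fastforce
  have inj: "a = b" if "c' a = c' b" "a \<in> insert t I" "b \<in> insert t I" for a b
    using that C' C_unique by metis
  have ratio: "c' l / c' m \<notin> R (l - m)" if "m \<in> insert t I" "l \<in> insert t I" "m < l" for m l
  proof (cases "l = t")
    case True
    then have m: "m \<in> I" using that by auto
    then have "c m \<noteq> 0" using C'[of m] C_nonzero c'I by force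
    then have "x / c m \<in> R (t - m) \<Longrightarrow> x \<in> excluded_ratio R I c t"
      unfolding excluded_ratio_def using m by (auto intro!: bexI[of _ m] image_eqI[of _ _ "x / c m"])
    then show ?thesis using nb True m by (auto simp: excluded_def c't c'I)
  next
    case False
    then have "l \<in> I" "m \<in> I" using that I[of l] by auto
    then show ?thesis using admissible that(3) by (auto simp: admissible_def c'I)
  qed
  \<comment> \<open>Every collision involving \<open>t\<close> without a shared index takes this
    form after commuting factors and sides; \<open>b = t\<close> is the square case.\<close>
  have core: "x * c' b \<noteq> c' d * c' e"
    if "b \<in> insert t I" "d \<in> I" "e \<in> I" "b \<noteq> d" for b d e
  proof
    assume eq: "x * c' b = c' d * c' e"
    have "e = (t + b + k - d) mod k"
      using C_class_index[OF x C' C' C' eq] that lt by auto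
    then have eq': "x * c' b = c d * c ((t + b + k - d) mod k)" using eq that by (simp add: c'I)
    show False
    proof (cases "b = t")
      case True
      then have "x \<in> excluded_square I c t"
        unfolding excluded_square_def using eq' that(2) C_nz[OF x] by (auto simp: power2_eq_square c't)
      then show ?thesis using nb by (simp add: excluded_def)
    next
      case False
      then have b: "b \<in> I" using that by auto
      then have "c b \<noteq> 0" using C'[of b] C_nonzero c'I by force
      then have "x = c d * c ((t + b + k - d) mod k) / c b"
        using eq' b by (simp add: c'I eq_divide_eq)
      then have "x \<in> excluded_prod I c t" unfolding excluded_prod_def using b that by blast
      then show ?thesis using nb by (simp add: excluded_def)
    qed
  qed
  have sidon: "a = d \<and> b = e \<or> a = e \<and> b = d"
    if mem: "a \<in> insert t I" "b \<in> insert t I" "d \<in> insert t I" "e \<in> insert t I"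
      and eq: "c' a * c' b = c' d * c' e" for a b d e
  proof -
    have nz: "c' a \<noteq> 0" "c' b \<noteq> 0" "c' d \<noteq> 0" "c' e \<noteq> 0"
      using C' mem C_nonzero by blast+
    consider "a = d" | "a = e" | "b = d" | "b = e"
      | (disj) "a \<noteq> d" "a \<noteq> e" "b \<noteq> d" "b \<noteq> e" by blast
    then show ?thesis
    proof cases
      case disj
      consider "a = t" | "b = t" | "d = t" | "e = t"
        | (none) "a \<in> I" "b \<in> I" "d \<in> I" "e \<in> I" using mem by blast
      then show ?thesis
      proof cases
        case 1 then show ?thesis using core[of b d e] mem disj eq by (auto simp: c't)
      next
        case 2 then show ?thesis using core[of a d e] mem disj eq by (auto simp: c't mult.commute)
      next
        case 3 then show ?thesis using core[of e a b] mem disj eq by (auto simp: c't)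
      next
        case 4 then show ?thesis using core[of d a b] mem disj eq by (auto simp: c't mult.commute)
      next
        case none
        then show ?thesis using admissible eq unfolding admissible_def by (simp add: c'I)
      qed
    qed (use eq nz mem inj in \<open>auto simp: mult.commute\<close>)
  qed
  show ?thesis
    unfolding admissible_def c'_def[symmetric]
    by (intro conjI ballI impI) (rule C', assumption, rule ratio, assumption+, rule sidon, assumption+)
qed

text \<open>At stage \<open>j\<close> the admissibility conditions exclude at most
  \<open>j * M + j * j\<close> elements of the coset \<open>C j\<close>, and the partial sums at
  most \<open>j + 1\<close> more, fewer than \<open>w\<close> in all. Counting the empty sum among
  the partial sums ensures that the last two elements will have a nonzero sum.\<close>

lemma admissible_greedy:
  assumes R: "\<And>\<delta>. card (R \<delta>) \<le> M" and w: "k * M + k * k < w" and j: "j \<le> k - 2"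
  shows "\<exists>c. admissible R {..<j} c \<and> inj_on (\<lambda>i. \<Sum>t<i. c t) {..j}"
  using j
proof (induction j)
  case 0
  then show ?case by (auto simp: admissible_def)
next
  case (Suc j)
  then obtain c where c: "admissible R {..<j} c" "inj_on (\<lambda>i. \<Sum>t<i. c t) {..j}" by auto
  let ?S = "\<lambda>i. \<Sum>t<i. c t"
  let ?excluded = "excluded R {..<j} c j \<union> (\<lambda>i. ?S i - ?S j) ` {..j}"
  have jk: "j + 3 \<le> k" using Suc.prems k3 by simp
  have "card (excluded R {..<j} c j) \<le> j * M + j * (j - 1) + j"
    using card_excluded[of "{..<j}" R M c j] R by simp
  moreover have "card ((\<lambda>i. ?S i - ?S j) ` {..j}) \<le> j + 1"
    using card_image_le[of "{..j}"] by simp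
  ultimately have "card ?excluded \<le> j * M + j * (j - 1) + j + (j + 1)"
    by (meson add_mono card_Un_le order_trans)
  also have "\<dots> \<le> k * M + k * k"
  proof -
    have "j * M \<le> k * M" using jk by simp
    moreover have "j * (j - 1) + j + (j + 1) \<le> j * j + 2 * j + 1" by (cases j) auto
    moreover have "(j + 1) * (j + 1) \<le> k * k" using jk by (intro mult_le_mono) auto
    moreover have "(j + 1) * (j + 1) = j * j + 2 * j + 1" by simp
    ultimately show ?thesis by linarith
  qed
  also have "\<dots> < card (C j)" using w card_C jk by simp
  finally have "\<not> C j \<subseteq> ?excluded" using card_mono[of ?excluded "C j"] by force
  then obtain x where x: "x \<in> C j" "x \<notin> ?excluded" by blast
  let ?c = "c(j := x)"
  have "admissible R (insert j {..<j}) ?c"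
    using x jk by (intro admissible_insert c) auto
  moreover have "insert j {..<j} = {..<Suc j}" by auto
  moreover have "inj_on (\<lambda>i. \<Sum>t<i. ?c t) {..Suc j}"
  proof -
    have old: "(\<Sum>t<i. ?c t) = ?S i" if "i \<le> j" for i using that by (intro sum.cong) auto
    have new: "(\<Sum>t<Suc j. ?c t) = ?S j + x" using old[of j] by simp
    have "?S j + x \<noteq> ?S i" if "i \<le> j" for i
      using x(2) that by (force simp: algebra_simps)
    then have "(\<Sum>t<Suc j. ?c t) \<notin> (\<lambda>i. \<Sum>t<i. ?c t) ` {..j}"
      using old new by auto
    moreover have "inj_on (\<lambda>i. \<Sum>t<i. ?c t) {..j}"
      using c(2) old by (auto simp: inj_on_def)
    moreover have "{..Suc j} = insert (Suc j) {..j}" by auto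
    ultimately show ?thesis by (simp only: inj_on_insert) auto
  qed
  ultimately show ?case by auto
qed

section \<open>Closing a block with two elements of prescribed sum\<close>

text \<open>The index \<open>e\<close> ranges over all numbers below \<open>k\<close>, not just over
  \<open>I\<close>: where \<open>c\<close> is not yet chosen its value is arbitrary and only
  enlarges the excluded set. The congruence form suits the case analysis for the last
  element.\<close>

lemma mem_excluded_prod_iff:
  assumes "I \<subseteq> {..<k}"
  shows "x \<in> excluded_prod I c t \<longleftrightarrow> (\<exists>b\<in>I. \<exists>d\<in>I. \<exists>e<k. d \<noteq> b \<and> (t + b) mod k = (d + e) mod k \<and>
    x = c d * c e / c b)" (is "?l = ?r")
proof
  assume ?l
  then obtain b d where bd: "b \<in> I" "d \<in> I" "d \<noteq> b" "x = c d * c ((t + b + k - d) mod k) / c b"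
    by (auto simp: excluded_prod_def)
  have "(d + (t + b + k - d)) mod k = (t + b) mod k" using bd assms by fastforce
  then have "(t + b) mod k = (d + (t + b + k - d) mod k) mod k" by (simp add: mod_add_right_eq)
  then show ?r using bd k3 by (intro bexI[of _ b] bexI[of _ d] exI[of _ "(t + b + k - d) mod k"]) auto
next
  assume ?r
  then obtain b d e where bd: "b \<in> I" "d \<in> I" "e < k" "d \<noteq> b" "(t + b) mod k = (d + e) mod k"
    "x = c d * c e / c b" by blast
  then have "e = (t + b + k - d) mod k" using assms by (intro index_from_mod_sum) auto
  then show ?l using bd by (auto simp: excluded_prod_def)
qed

lemma mem_excluded_square_iff:
  assumes "I \<subseteq> {..<k}"
  shows "x \<in> excluded_square I c t \<longleftrightarrow> x \<in> nz_squares \<and>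
    (\<exists>d\<in>I. \<exists>e<k. (t + t) mod k = (d + e) mod k \<and> x^2 = c d * c e)" (is "?l = ?r")
proof
  assume ?l
  then obtain d where bd: "x \<in> nz_squares" "d \<in> I" "x^2 = c d * c ((t + t + k - d) mod k)"
    by (auto simp: excluded_square_def)
  have "(d + (t + t + k - d)) mod k = (t + t) mod k" using bd assms by fastforce
  then have "(t + t) mod k = (d + (t + t + k - d) mod k) mod k" by (simp add: mod_add_right_eq)
  then show ?r using bd k3
    by (intro conjI bexI[of _ d] exI[of _ "(t + t + k - d) mod k"]) auto
next
  assume ?r
  then obtain d e where bd: "x \<in> nz_squares" "d \<in> I" "e < k" "(t + t) mod k = (d + e) mod k"
    "x^2 = c d * c e" by blast
  then have "e = (t + t + k - d) mod k" using assms by (intro index_from_mod_sum) auto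
  then show ?l using bd by (auto simp: excluded_square_def)
qed

text \<open>The last two elements \<open>x\<close> and \<open>y = s - x\<close> are chosen together,
  so conditions on \<open>y\<close> and conditions mixing both become conditions on
  \<open>x\<close>. The sets \<open>E0\<close> to \<open>E7\<close> have at most
  \<open>h * M + h * h\<close> (twice), \<open>M\<close>, \<open>2 * h\<close>, \<open>h\<close>, 2,
  2 and \<open>h - 1\<close> elements, which add up to the bound.\<close>

lemma admissible_complete:
  assumes R: "\<And>\<delta>. card (R \<delta>) \<le> M" and kh: "k = h + 2"
    and c: "admissible R {..<h} c" and inj: "inj_on (\<lambda>i. \<Sum>t<i. c t) {..h}"
    and N: "(2 * h + 1) * M + 2 * (h * h) + 4 * h + 3
      < card {x \<in> C h. - (\<Sum>t<h. c t) - x \<in> C (h + 1)}"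
  shows "\<exists>c. admissible R {..<k} c \<and> inj_on (\<lambda>i. \<Sum>t<i. c t) {..<k} \<and> (\<Sum>t<k. c t) = 0"
proof -
  have h: "h \<ge> 1" using k3 kh by simp
  let ?S = "\<lambda>i. \<Sum>t<i. c t"
  let ?I = "{..<h}" and ?Y = "h + 1"
  define s where "s = - ?S h"
  have s0: "s \<noteq> 0" using inj_onD[OF inj, of h 0] h unfolding s_def by auto
  have cC: "c i \<in> C i" if "i < h" for i using c that by (simp add: admissible_def)
  then have c0: "c i \<noteq> 0" if "i < h" for i using that C_nonzero by blast
  \<comment> \<open>\<open>E0\<close> and \<open>E1\<close> treat collisions of \<open>x\<close>
    alone and of \<open>y\<close> alone with the earlier elements. In \<open>E2\<close>, a forbidden
    quotient \<open>y = r * x\<close> together with \<open>x + y = s\<close> gives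
    \<open>x = s / (r + 1)\<close>.\<close>
  define E0 where "E0 = excluded R ?I c h"
  define E1 where "E1 = {x. s - x \<in> excluded R ?I c ?Y}"
  define E2 where "E2 = (\<lambda>r. s / (r + 1)) ` R 1"
  \<comment> \<open>\<open>E3\<close> to \<open>E6\<close> treat equations containing both
    \<open>x\<close> and \<open>y\<close>. Modulo \<open>k = h + 2\<close> the cosets leave only
    \<open>x * y = c d * c e\<close> with \<open>e\<close> determined by \<open>d\<close>,
    \<open>y * c b = x * c (b + 1)\<close>, \<open>y * c (h - 1) = x^2\<close> and
    \<open>y^2 = x * c 0\<close>.\<close>
  define E3 where "E3 = (\<Union>d\<in>?I. {x. x * (s - x) = c d * c ((h + ?Y + k - d) mod k)})"
  define E4 where "E4 = (\<Union>b\<in>?I. {x. (s - x) * c b = x * c (b + 1)})"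
  define E5 where "E5 = {x. (s - x) * c (h - 1) = x^2}"
  define E6 where "E6 = {x. (s - x)^2 = x * c 0}"
  \<comment> \<open>The new partial sum is \<open>- y\<close>. It differs from \<open>?S 0\<close>
    because \<open>y \<noteq> 0\<close> and from \<open>?S h\<close> because
    \<open>x \<noteq> 0\<close>, so only the indices strictly between need exclusion.\<close>
  define E7 where "E7 = (\<lambda>i. ?S i - ?S h) ` {1..<h}"
  have hh: "h * (h - 1) + h = h * h" using h by (cases h) auto
  have q0: "card E0 \<le> h * M + h * h"
    using card_excluded[of ?I R M c h] R hh unfolding E0_def by simp
  have q1: "card E1 \<le> h * M + h * h"
  proof -
    have "card E1 \<le> card (excluded R ?I c ?Y)"
      unfolding E1_def by (intro card_inj_on_le[of "\<lambda>x. s - x"]) (auto simp: inj_on_def)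
    then show ?thesis using card_excluded[of ?I R M c ?Y] R hh by simp
  qed
  have q2: "card E2 \<le> M" unfolding E2_def by (rule order_trans[OF card_image_le R]) simp
  have q3: "card E3 \<le> h * 2"
  proof -
    have *: "card {x. x * (s - x) = A} \<le> 2" for A
    proof -
      have "{x. x * (s - x) = A} = {x. x^2 + (- s) * x + A = 0}"
        by (auto simp: power2_eq_square algebra_simps)
      then show ?thesis using card_quadratic_roots_le[of "- s" A] by simp
    qed
    have "card E3 \<le> card ?I * 2" unfolding E3_def
      by (rule card_scaled_UN_le, simp, rule *)
    then show ?thesis by simp
  qed
  have q4: "card E4 \<le> h * 1"
  proof -
    \<comment> \<open>For \<open>b = h - 1\<close> the value \<open>c h\<close> is an arbitrary
      default; the bound holds whatever \<open>c (b + 1)\<close> is, because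
      \<open>s * c b \<noteq> 0\<close>.\<close>
    have *: "card {x. (s - x) * c b = x * c (b + 1)} \<le> 1" if b: "b \<in> ?I" for b
    proof -
      have "x = y" if xy: "(s - x) * c b = x * c (b + 1)" "(s - y) * c b = y * c (b + 1)" for x y
      proof -
        have x: "s * c b = x * (c b + c (b + 1))" and y: "s * c b = y * (c b + c (b + 1))"
          using xy by (simp_all add: algebra_simps)
        have "s * c b \<noteq> 0" using s0 c0 b by simp
        then have "c b + c (b + 1) \<noteq> 0" using x by auto
        then show "x = y" using x y by simp
      qed
      then show ?thesis by (intro card_le_one) blast
    qed
    have "card E4 \<le> card ?I * 1" unfolding E4_def
      by (rule card_scaled_UN_le, simp, rule *, assumption)
    then show ?thesis by simp
  qed
  have q5: "card E5 \<le> 2"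
  proof -
    have *: "x^2 + c (h - 1) * x + (- s * c (h - 1)) = x^2 - (s - x) * c (h - 1)" for x
      by (simp add: algebra_simps)
    have "E5 = {x. x^2 + c (h - 1) * x + (- s * c (h - 1)) = 0}"
      unfolding E5_def * right_minus_eq by (rule Collect_cong) (rule eq_commute)
    then show ?thesis using card_quadratic_roots_le[of "c (h - 1)" "- s * c (h - 1)"] by simp
  qed
  have q6: "card E6 \<le> 2"
  proof -
    have *: "x^2 + (- 2 * s - c 0) * x + s^2 = (s - x)^2 - x * c 0" for x
      by (simp add: power2_eq_square algebra_simps)
    have "E6 = {x. x^2 + (- 2 * s - c 0) * x + s^2 = 0}"
      unfolding E6_def * right_minus_eq ..
    then show ?thesis using card_quadratic_roots_le[of "- 2 * s - c 0" "s^2"] by simp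
  qed
  have q7: "card E7 \<le> h - 1" unfolding E7_def using card_image_le[of "{1..<h}"] by simp
  let ?E = "E0 \<union> E1 \<union> E2 \<union> E3 \<union> E4 \<union> E5 \<union> E6 \<union> E7"
  have "card ?E \<le> card E0 + card E1 + card E2 + card E3 + card E4 + card E5 + card E6 + card E7"
    by (intro order_trans[OF card_Un_le] add_mono order_refl)
  also have "\<dots> \<le> (2 * h + 1) * M + 2 * (h * h) + 4 * h + 3"
    using q0 q1 q2 q3 q4 q5 q6 q7 h by (simp add: algebra_simps)
  also have "\<dots> < card {x \<in> C h. s - x \<in> C ?Y}" using N by (simp add: s_def)
  finally have "\<not> {x \<in> C h. s - x \<in> C ?Y} \<subseteq> ?E"
    using card_mono[of ?E "{x \<in> C h. s - x \<in> C ?Y}"] by force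
  then obtain x where x: "x \<in> C h" "s - x \<in> C ?Y" "x \<notin> ?E" by blast
  define y where "y = s - x"
  have y: "y \<in> C ?Y" using x by (simp add: y_def)
  have x0: "x \<noteq> 0" and y0: "y \<noteq> 0" using x y C_nonzero by blast+
  define c' where "c' = c(h := x)"
  have c'h: "c' h = x" and c'I: "\<And>i. i \<noteq> h \<Longrightarrow> c' i = c i" by (simp_all add: c'_def)
  have adm1: "admissible R (insert h ?I) c'"
    unfolding c'_def using c x kh by (intro admissible_insert) (auto simp: E0_def)
  have cancel: "a mod k = b mod k" if "(a + h) mod k = (b + h) mod k" for a b
    using that cong_add_rcancel_nat[of a h b k] by (simp add: cong_def)
  have IsubI: "?I \<subseteq> {..<k}" "insert h ?I \<subseteq> {..<k}" using kh by auto
  have nbad: "y \<notin> excluded R ?I c ?Y" using x by (simp add: E1_def y_def)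
  have n1: "y \<notin> excluded_ratio R (insert h ?I) c' ?Y"
  proof
    assume "y \<in> excluded_ratio R (insert h ?I) c' ?Y"
    then obtain m r where m: "m \<in> insert h ?I" "r \<in> R (?Y - m)" "y = r * c' m"
      unfolding excluded_ratio_def by blast
    show False
    proof (cases "m = h")
      case True
      then have r: "r \<in> R 1" "s = x * (r + 1)" using m by (auto simp: c'h y_def algebra_simps)
      then have "r + 1 \<noteq> 0" using s0 by auto
      then have "x \<in> E2" unfolding E2_def using r by (auto intro!: image_eqI[of _ _ r])
      then show False using x by blast
    next
      case False
      then have "y \<in> excluded_ratio R ?I c ?Y" using m by (auto simp: excluded_ratio_def c'I)
      then show False using nbad by (simp add: excluded_def)
    qed
  qed
  have n2: "y \<notin> excluded_prod (insert h ?I) c' ?Y"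
  proof
    assume "y \<in> excluded_prod (insert h ?I) c' ?Y"
    then obtain b d e where b: "b \<in> insert h ?I" "d \<in> insert h ?I" "e < k" "d \<noteq> b"
      and m: "(?Y + b) mod k = (d + e) mod k" and eq: "y = c' d * c' e / c' b"
      unfolding mem_excluded_prod_iff[OF IsubI(2)] by blast
    have "c' b \<noteq> 0" using b(1) adm1 C_nonzero by (auto simp: admissible_def)
    then have eq': "y * c' b = c' d * c' e" using eq by simp
    \<comment> \<open>The element \<open>x\<close> is the partner of \<open>y\<close>, or the factor
      \<open>c' d\<close>, or at most the factor \<open>c' e\<close>. These lead to
      \<open>E3\<close>, to \<open>E4\<close> or \<open>E5\<close>, and to \<open>E4\<close> or a
      collision of \<open>y\<close> with earlier elements.\<close>
    consider "b = h" | "b < h" "d = h" | "b < h" "d < h" using b by auto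
    then show False
    proof cases
      case 1
      then have d: "d < h" using b by auto
      have "e \<noteq> h"
      proof
        assume "e = h"
        then have "?Y mod k = d mod k" using m 1 by - (rule cancel, simp)
        then show False using d kh by simp
      qed
      moreover have "e = (h + ?Y + k - d) mod k"
        using m 1 d b(3) kh by (intro index_from_mod_sum) (simp_all add: add.commute)
      ultimately have "x * y = c d * c ((h + ?Y + k - d) mod k)"
        using eq' 1 d by (simp add: c'h c'I mult.commute)
      then have "x \<in> E3" unfolding E3_def y_def using d by blast
      then show False using x by blast
    next
      case 2
      have "(b + 1) mod k = e mod k" using m 2 by - (rule cancel, simp add: ac_simps)
      then have e: "e = b + 1" using 2 kh b(3) by simp
      show False
      proof (cases "e = h")
        case True
        then have "b = h - 1" using e by simp
        then have "y * c (h - 1) = x^2"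
          using eq' 2(2) True h by (simp add: c'h c'I power2_eq_square)
        then have "x \<in> E5" by (simp add: E5_def y_def)
        then show False using x by blast
      next
        case False
        then have "y * c b = x * c (b + 1)" using eq' 2 e by (simp add: c'h c'I)
        then have "x \<in> E4" unfolding E4_def y_def using 2 by blast
        then show False using x by blast
      qed
    next
      case 3
      show False
      proof (cases "e = h")
        case True
        have "(b + 1) mod k = d mod k" using m True by - (rule cancel, simp add: ac_simps)
        then have "d = b + 1" using 3 kh by simp
        then have "y * c b = x * c (b + 1)" using eq' 3 True by (simp add: c'h c'I mult.commute)
        then have "x \<in> E4" unfolding E4_def y_def using 3 by blast
        then show False using x by blast
      next
        case False
        then have "y = c d * c e / c b" using eq 3 by (simp add: c'I)
        then have "y \<in> excluded_prod ?I c ?Y"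
          unfolding mem_excluded_prod_iff[OF IsubI(1)] using 3 b m by blast
        then show False using nbad by (simp add: excluded_def)
      qed
    qed
  qed
  have n3: "y \<notin> excluded_square (insert h ?I) c' ?Y"
  proof
    assume "y \<in> excluded_square (insert h ?I) c' ?Y"
    then obtain d e where b: "d \<in> insert h ?I" "e < k" "y \<in> nz_squares"
      and m: "(?Y + ?Y) mod k = (d + e) mod k" and eq: "y^2 = c' d * c' e"
      unfolding mem_excluded_square_iff[OF IsubI(2)] by blast
    have E6: "y^2 \<noteq> x * c 0" using x by (simp add: E6_def y_def)
    show False
    proof (cases "d = h")
      case True
      have "(h + 2) mod k = e mod k" using m True by - (rule cancel, simp add: ac_simps)
      then have "e = 0" using kh b by simp
      then show False using eq True E6 h by (simp add: c'h c'I)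
    next
      case d: False
      show False
      proof (cases "e = h")
        case True
        have "(h + 2) mod k = d mod k" using m True by - (rule cancel, simp add: ac_simps)
        then have "d = 0" using kh b(1) d by auto
        then show False using eq True E6 h by (simp add: c'h c'I mult.commute)
      next
        case False
        then have "y^2 = c d * c e" using eq d by (simp add: c'I)
        then have "y \<in> excluded_square ?I c ?Y"
          unfolding mem_excluded_square_iff[OF IsubI(1)]
          using d b m by (intro conjI bexI[of _ d] exI[of _ e]) auto
        then show False using nbad by (simp add: excluded_def)
      qed
    qed
  qed
  define c'' where "c'' = c'(h + 1 := y)"
  have nbY: "y \<notin> excluded R (insert h ?I) c' ?Y" using n1 n2 n3 by (simp add: excluded_def)
  have "admissible R (insert ?Y (insert h ?I)) c''"
    unfolding c''_def by (rule admissible_insert[OF adm1 y _ _ nbY]) (use kh in auto)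
  moreover have "insert ?Y (insert h ?I) = {..<k}" using kh by auto
  ultimately have adm2: "admissible R {..<k} c''" by (simp only:)
  have old: "(\<Sum>t<i. c'' t) = ?S i" if "i \<le> h" for i
    using that by (intro sum.cong) (auto simp: c''_def c'_def)
  have S1: "(\<Sum>t<Suc h. c'' t) = - y" using old[of h] by (simp add: c''_def c'_def y_def s_def)
  have S2: "(\<Sum>t<k. c'' t) = 0"
  proof -
    have "(\<Sum>t<k. c'' t) = (\<Sum>t<Suc h. c'' t) + c'' (Suc h)" by (simp add: kh)
    also have "\<dots> = 0" unfolding S1 by (simp add: c''_def)
    finally show ?thesis .
  qed
  have "- y \<noteq> ?S i" if i: "i \<le> h" for i
  proof -
    have "i = 0 \<or> i = h \<or> i \<in> {1..<h}" using i by auto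
    then consider "i = 0" | "i = h" | "i \<in> {1..<h}" by blast
    then show ?thesis
    proof cases
      case 1 then show ?thesis using y0 by simp
    next
      case 2 then show ?thesis using x0 by (simp add: y_def s_def)
    next
      case 3
      then have "x \<noteq> ?S i - ?S h" using x(3) unfolding E7_def by blast
      moreover have "- y - ?S i = x - (?S i - ?S h)" by (simp add: y_def s_def)
      ultimately show ?thesis by (metis right_minus_eq)
    qed
  qed
  then have "(\<Sum>t<Suc h. c'' t) \<notin> (\<lambda>i. \<Sum>t<i. c'' t) ` {..h}"
    unfolding S1 using old by (auto simp del: sum.lessThan_Suc)
  moreover have "inj_on (\<lambda>i. \<Sum>t<i. c'' t) {..h}"
    using inj old by (auto simp: inj_on_def)
  moreover have "{..<k} = insert (Suc h) {..h}" using kh by auto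
  ultimately have "inj_on (\<lambda>i. \<Sum>t<i. c'' t) {..<k}" by (simp only: inj_on_insert) auto
  then show ?thesis using adm2 S2 by blast
qed

section \<open>Families of blocks\<close>

text \<open>The last clause is the cross-multiplied form of the statement that quotients never
  repeat. Only the partial sums with index below \<open>k\<close> are compared, because the full sum
  returns to the empty one.\<close>

definition valid_blocks :: "nat \<Rightarrow> (nat \<Rightarrow> nat \<Rightarrow> 'a) \<Rightarrow> bool" where
  "valid_blocks n b \<longleftrightarrow>
     (\<forall>i<n. (\<forall>j<k. b i j \<in> C j) \<and> (\<Sum>j<k. b i j) = 0 \<and> inj_on (\<lambda>j. \<Sum>t<j. b i t) {..<k}) \<and>
     (\<forall>i<n. \<forall>i'<n. \<forall>l<k. \<forall>m<k. \<forall>l'<k. \<forall>m'<k. l \<noteq> m \<longrightarrow>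
        b i l * b i' m' = b i' l' * b i m \<longrightarrow> i = i' \<and> l = l' \<and> m = m')"

definition old_ratios :: "nat \<Rightarrow> (nat \<Rightarrow> nat \<Rightarrow> 'a) \<Rightarrow> nat \<Rightarrow> 'a set" where
  "old_ratios n b \<delta> = (\<lambda>(i, m). b i ((\<delta> + m) mod k) / b i m) ` ({..<n} \<times> {..<k})"

lemma card_old_ratios: "card (old_ratios n b \<delta>) \<le> n * k"
  unfolding old_ratios_def using card_image_le[of "{..<n} \<times> {..<k}"] by simp

text \<open>Repeated quotients inside the new block contradict the product condition. Between the
  new block and an old one, the cosets place the quotient in \<open>old_ratios n b (l - m)\<close>
  if \<open>m < l\<close>; the other order follows by taking reciprocals.\<close>

lemma valid_blocks_extend:
  assumes g: "valid_blocks n b" and c: "admissible (old_ratios n b) {..<k} c"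
    "inj_on (\<lambda>i. \<Sum>t<i. c t) {..<k}" "(\<Sum>t<k. c t) = 0"
  shows "valid_blocks (Suc n) (b(n := c))"
proof -
  let ?b = "b(n := c)"
  have bC: "b i j \<in> C j" if "i < n" "j < k" for i j using g that by (simp add: valid_blocks_def)
  have cC: "c j \<in> C j" if "j < k" for j using c that by (simp add: admissible_def)
  have old: "False" if i: "i < n" and lt: "l < k" "m < k" "l' < k" "m' < k" and ml: "m < l"
    and eq: "c l * b i m' = b i l' * c m" for i l m l' m'
  proof -
    have "(l + m') mod k = (m + l') mod k"
      using C_class[OF cC bC cC bC, of l i m' m i l'] eq lt i by (simp add: mult.commute)
    then have "l' = (l + m' + k - m) mod k" using lt by (intro index_from_mod_sum)
    also have "l + m' + k - m = (l - m + m') + k" using ml by simp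
    finally have l': "l' = (l - m + m') mod k" by simp
    have "c m \<noteq> 0" "b i m' \<noteq> 0" using bC cC C_nonzero lt i by blast+
    then have "c l / c m = b i l' / b i m'" using eq by (simp add: frac_eq_eq)
    then have "c l / c m \<in> old_ratios n b (l - m)"
      unfolding old_ratios_def l' using i lt by (auto intro!: image_eqI[of _ _ "(i, m')"])
    then show False using c lt ml by (auto simp: admissible_def)
  qed
  have old': "False" if i: "i < n" and lt: "l < k" "m < k" "l' < k" "m' < k" and ml: "l \<noteq> m"
    and eq: "c l * b i m' = b i l' * c m" for i l m l' m'
  proof (cases "m < l")
    case True
    then show ?thesis using old[OF i lt True eq] by blast
  next
    case False
    then have "l < m" using ml by simp
    moreover have "c m * b i l' = b i m' * c l" using eq by (simp add: mult.commute)
    ultimately show ?thesis using old[of i m l m' l'] i lt by blast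
  qed
  have ratio: "i = i' \<and> l = l' \<and> m = m'"
    if i: "i < Suc n" "i' < Suc n" and lt: "l < k" "m < k" "l' < k" "m' < k" and lm: "l \<noteq> m"
      and eq: "?b i l * ?b i' m' = ?b i' l' * ?b i m" for i i' l m l' m'
  proof -
    consider "i < n" "i' < n" | "i = n" "i' = n" | "i = n" "i' < n" | "i < n" "i' = n"
      using i by linarith
    then show ?thesis
    proof cases
      case 1
      then have "b i l * b i' m' = b i' l' * b i m" using eq by simp
      then show ?thesis using g 1 lt lm unfolding valid_blocks_def by blast
    next
      case 2
      then have "c l * c m' = c l' * c m" using eq by simp
      moreover have "\<And>a b d e. a < k \<Longrightarrow> b < k \<Longrightarrow> d < k \<Longrightarrow> e < k \<Longrightarrow> c a * c b = c d * c e \<Longrightarrow>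
          a = d \<and> b = e \<or> a = e \<and> b = d"
        using c(1) unfolding admissible_def by (meson lessThan_iff)
      ultimately show ?thesis using lt lm 2 by blast
    next
      case 3
      then show ?thesis using old'[of i' l m l' m'] lt lm eq by simp
    next
      case 4
      then have eq': "b i l * c m' = c l' * b i m" using eq by simp
      \<comment> \<open>Exchanging the roles of the two blocks needs distinct indices in the new
        block, whereas only \<open>l \<noteq> m\<close> is given.\<close>
      have "l' \<noteq> m'"
      proof
        assume "l' = m'"
        then have "b i l = b i m" using eq' cC[of m'] lt C_nonzero by (simp add: mult.commute)
        then show False using bC[of i] 4 lt lm C_unique by metis
      qed
      moreover have "c l' * b i m = b i l * c m'" using eq' by simp
      ultimately show ?thesis using old'[of i l' m' l m] lt 4 by blast
    qed
  qed
  have block: "(\<forall>j<k. ?b i j \<in> C j) \<and> (\<Sum>j<k. ?b i j) = 0 \<and> inj_on (\<lambda>j. \<Sum>t<j. ?b i t) {..<k}"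
    if "i < Suc n" for i
  proof (cases "i = n")
    case True
    then show ?thesis using c(2,3) cC by simp
  next
    case False
    then show ?thesis using g that by (simp add: valid_blocks_def)
  qed
  show ?thesis
    unfolding valid_blocks_def
    by (intro conjI[OF allI[OF impI[OF block]]] allI impI, assumption, rule ratio)
qed

text \<open>Blocks are added one at a time with \<open>n\<close> fixed. With \<open>j\<close> blocks
  present each class has at most \<open>j * k\<close> old quotients, so a bound depending only on
  the final \<open>n\<close> serves every stage.\<close>

lemma valid_blocks_exists:
  assumes q: "card (UNIV :: 'a set) = 2 * k * w + 1" and n: "card (UNIV :: 'a set) > 8 * k ^ 5 * n"
    and j: "j \<le> n"
  shows "\<exists>b. valid_blocks j b"
  using j
proof (induction j)
  case 0
  then show ?case by (auto simp: valid_blocks_def)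
next
  case (Suc j)
  then obtain b where b: "valid_blocks j b" by auto
  define h where "h = k - 2"
  have kh: "k = h + 2" using k3 by (simp add: h_def)
  have h: "h \<ge> 1" using k3 kh by simp
  define M where "M = j * k"
  have R: "card (old_ratios j b \<delta>) \<le> M" for \<delta> using card_old_ratios by (simp add: M_def)
  have jn: "Suc j \<le> n" using Suc.prems by simp
  have "k * M + k * k < w"
  proof -
    have "2 * k * (4 * k^4 * n) = 8 * k^5 * n" by (simp add: power_numeral_reduce)
    then have "2 * k * (4 * k^4 * n) \<le> 2 * k * w" using n q by linarith
    then have "4 * k^4 * n \<le> w" using k3 by (metis mult_le_cancel1 mult_pos_pos not_numeral_le_zero zero_less_numeral neq0_conv)
    moreover have "k^2 \<le> k^4" using k3 by (intro power_increasing) auto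
    then have "k^2 * Suc j \<le> k^4 * n" using jn by (intro mult_le_mono)
    moreover have "k^4 * n > 0" using jn k3 by simp
    moreover have "k * M + k * k = k^2 * Suc j" by (simp add: M_def power2_eq_square algebra_simps)
    ultimately show ?thesis by linarith
  qed
  from admissible_greedy[of "old_ratios j b" M h, OF R this] obtain c where c: "admissible (old_ratios j b) {..<h} c"
    "inj_on (\<lambda>i. \<Sum>t<i. c t) {..h}" unfolding h_def by blast
  define s where "s = - (\<Sum>t<h. c t)"
  define N where "N = card {x \<in> C h. s - x \<in> C (h + 1)}"
  have s0: "s \<noteq> 0" using inj_onD[OF c(2), of h 0] h unfolding s_def by auto
  have N: "real N > real n * real k * (2 * real k - 3)"
  proof (rule representation_count_bound)
    show "real k \<ge> 3" "real n \<ge> 1" using k3 jn by auto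
    show "real (card (UNIV :: 'a set)) = 2 * real k * real w + 1" using q by simp
    have "real (8 * k^5 * n) < real (card (UNIV :: 'a set))" using n by (simp only: of_nat_less_iff)
    then show "8 * real k ^ 5 * real n < real (card (UNIV :: 'a set))" by simp
    show "(real N - (real w)\<^sup>2 / real (card (UNIV :: 'a set)))\<^sup>2 \<le> real (card (UNIV :: 'a set))"
      unfolding N_def by (rule card_sum_representations) (use kh s0 in auto)
  qed
  have "2 * real k - 3 = real (2 * h + 1)" using kh by simp
  then have "real (n * k * (2 * h + 1)) < real N" using N by (simp only: of_nat_mult)
  then have N': "n * k * (2 * h + 1) < N" by (simp only: of_nat_less_iff)
  \<comment> \<open>\<open>(2 * h + 1) * (h + 2) = 2 * h^2 + 5 * h + 2\<close>, so
    \<open>h \<ge> 1\<close> suffices, with equality for k = 3.\<close>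
  have "(2 * h + 1) * M + 2 * (h * h) + 4 * h + 3 \<le> (2 * h + 1) * M + (2 * h + 1) * k"
    using h unfolding kh by (simp add: algebra_simps)
  also have "\<dots> = Suc j * k * (2 * h + 1)" by (simp add: M_def algebra_simps)
  also have "\<dots> \<le> n * k * (2 * h + 1)" using jn by (intro mult_le_mono1)
  also note N'
  finally have "\<exists>c. admissible (old_ratios j b) {..<k} c \<and> inj_on (\<lambda>i. \<Sum>t<i. c t) {..<k} \<and> (\<Sum>t<k. c t) = 0"
    using admissible_complete[of "old_ratios j b" M h c, OF R kh c] unfolding N_def s_def by blast
  then show ?case using valid_blocks_extend[OF b] by blast
qed

section \<open>From blocks to Heffter difference packings\<close>

lemma heffter_dp_of_valid_blocks:
  assumes g: "valid_blocks n b"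
  shows "heffter_dp \<phi> (k * w) k n (\<lambda>i. b i ` {..<k})"
    and "i < n \<Longrightarrow> distinct_partial_sums_ordering (b i ` {..<k})"
proof -
  have bC: "b i j \<in> C j" if "i < n" "j < k" for i j using g that by (simp add: valid_blocks_def)
  have nz: "b i j \<in> nz_squares" if "i < n" "j < k" for i j using bC that C_nz by blast
  have md: "\<phi> (b i j) mod k = j" if "i < n" "j < k" for i j using bC that by (auto simp: C_def)
  have inj: "inj_on (b i) {..<k}" if "i < n" for i
    using bC[OF that] C_unique by (metis inj_onI lessThan_iff)
  have diff: "i = i' \<and> l = l' \<and> m = m'"
    if i: "i < n" "i' < n" and lt: "l < k" "m < k" "l' < k" "m' < k" and lm: "l \<noteq> m"
      and eq: "(int (\<phi> (b i l)) - int (\<phi> (b i m))) mod int (k * w)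
        = (int (\<phi> (b i' l')) - int (\<phi> (b i' m'))) mod int (k * w)" for i i' l m l' m'
  proof -
    \<comment> \<open>Adding both subtrahends turns equal differences into congruent sums of
      naturals, which \<open>\<phi>\<close> translates back into equal products.\<close>
    have "[int (\<phi> (b i l)) - int (\<phi> (b i m)) + (int (\<phi> (b i m)) + int (\<phi> (b i' m')))
        = int (\<phi> (b i' l')) - int (\<phi> (b i' m')) + (int (\<phi> (b i m)) + int (\<phi> (b i' m')))] (mod int (k * w))"
      using eq by (intro cong_add cong_refl) (simp only: cong_def)
    then have "[int (\<phi> (b i l) + \<phi> (b i' m')) = int (\<phi> (b i' l') + \<phi> (b i m))] (mod int (k * w))"
      by (simp add: algebra_simps)
    then have "[\<phi> (b i l) + \<phi> (b i' m') = \<phi> (b i' l') + \<phi> (b i m)] (mod k * w)"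
      by (simp only: cong_int_iff)
    then have "\<phi> (b i l * b i' m') = \<phi> (b i' l' * b i m)"
      using i lt nz by (simp add: phi_mult cong_def)
    then have "b i l * b i' m' = b i' l' * b i m"
      using i lt nz by (intro phi_inj nz_squares_mult)
    then show ?thesis using g i lt lm unfolding valid_blocks_def by blast
  qed
  show "heffter_dp \<phi> (k * w) k n (\<lambda>i. b i ` {..<k})"
    unfolding heffter_dp_def
  proof (intro conjI)
    show "\<forall>i<n. b i ` {..<k} \<subseteq> nz_squares \<and> finite (b i ` {..<k}) \<and> card (b i ` {..<k}) = k"
      using nz inj by (auto simp: card_image)
    show "inj_on (\<lambda>(i, a, b). (int a - int b) mod int (k * w))
       {(i, a, ba). i < n \<and> a \<in> \<phi> ` b i ` {..<k} \<and> ba \<in> \<phi> ` b i ` {..<k} \<and> a \<noteq> ba}"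
    proof (rule inj_onI)
      fix p p'
      let ?S = "{(i, a, ba). i < n \<and> a \<in> \<phi> ` b i ` {..<k} \<and> ba \<in> \<phi> ` b i ` {..<k} \<and> a \<noteq> ba}"
      let ?f = "\<lambda>(i, a, b). (int a - int b) mod int (k * w)"
      assume p: "p \<in> ?S" and p': "p' \<in> ?S" and eq: "?f p = ?f p'"
      obtain i l m where ilm: "i < n" "l < k" "m < k" "p = (i, \<phi> (b i l), \<phi> (b i m))"
        "\<phi> (b i l) \<noteq> \<phi> (b i m)" using p by auto
      obtain i' l' m' where ilm': "i' < n" "l' < k" "m' < k" "p' = (i', \<phi> (b i' l'), \<phi> (b i' m'))"
        using p' by auto
      show "p = p'"
        using diff[of i i' l m l' m'] ilm ilm' eq by auto
    qed
    show "k dvd k * w" by simp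
    show "\<forall>i<n. \<forall>a\<in>\<phi> ` b i ` {..<k}. \<forall>ba\<in>\<phi> ` b i ` {..<k}. a \<noteq> ba \<longrightarrow> a mod k \<noteq> ba mod k"
      using md by auto
    show "\<forall>i<n. (\<Sum>x\<in>b i ` {..<k}. x) = 0"
      using g inj by (simp add: sum.reindex valid_blocks_def)
  qed
  show "distinct_partial_sums_ordering (b i ` {..<k})" if i: "i < n"
    unfolding distinct_partial_sums_ordering_def
  proof (intro exI conjI)
    let ?bs = "map (b i) [0..<k]" and ?S = "\<lambda>j. \<Sum>t<j. b i t"
    show "distinct ?bs" using inj[OF i] by (simp add: distinct_map atLeast0LessThan)
    show "set ?bs = b i ` {..<k}" by (simp add: atLeast0LessThan)
    have S: "sum_list (take (Suc j) ?bs) = ?S (Suc j)" if "j < k" for j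
      using that by (simp add: take_map sum_list_distinct_conv_sum_set atLeast0LessThan del: upt_Suc)
    have Sinj: "inj_on ?S {..<k}" and Sk: "?S k = ?S 0" using g i by (auto simp: valid_blocks_def)
    have "inj_on (\<lambda>j. ?S (Suc j)) {..<k}"
    proof (rule inj_onI)
      fix j j' assume jj: "j \<in> {..<k}" "j' \<in> {..<k}" and eq: "?S (Suc j) = ?S (Suc j')"
      \<comment> \<open>The ordering asks for the sums \<open>?S 1\<close> to \<open>?S k\<close>,
        while \<open>Sinj\<close> covers \<open>?S 0\<close> to \<open>?S (k - 1)\<close>. Since
        \<open>?S k = ?S 0\<close>, the index \<open>k\<close> is wrapped to 0.\<close>
      define r where "r = (\<lambda>j. if Suc j = k then 0 else Suc j)"
      have "?S (r j) = ?S (r j')" using eq Sk by (auto simp: r_def simp del: sum.lessThan_Suc)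
      then have "r j = r j'" using Sinj jj by (rule_tac inj_onD[OF Sinj]) (auto simp: r_def)
      then show "j = j'" by (auto simp: r_def split: if_splits)
    qed
    then show "distinct (map (\<lambda>j. sum_list (take (Suc j) ?bs)) [0..<length ?bs])"
      using S by (simp add: distinct_map atLeast0LessThan inj_on_def del: sum.lessThan_Suc upt_Suc)
  qed
qed

end

theorem theorem4p7:
  fixes k n q :: nat and \<phi> :: "'a::{field, finite} \<Rightarrow> nat"
  assumes "k \<ge> 3" and "odd k"
    and "q = card (UNIV :: 'a set)"
    and "\<exists>p m. prime p \<and> m > 0 \<and> q = p ^ m"
    and "[q = 2 * k + 1] (mod (4 * k))"
    and "q > 8 * k ^ 5 * n"
    and "sq_iso \<phi> ((q - 1) div 2)"
  shows "\<exists>B. heffter_dp \<phi> ((q - 1) div 2) k n B \<and>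
             (\<forall>i<n. distinct_partial_sums_ordering (B i))"
proof -
  \<comment> \<open>From q = 4kt + 2k + 1 one gets (q - 1) / 2 = k (2t + 1), whose second factor is
    \<open>w\<close>; it is odd, and so is \<open>k * w\<close>.\<close>
  define t where "t = q div (4 * k)"
  have "q mod (4 * k) = 2 * k + 1" using assms(1,5) by (simp add: cong_def)
  then have qt: "q = 4 * k * t + 2 * k + 1"
    using mult_div_mod_eq[of "4 * k" q] unfolding t_def by linarith
  define w where "w = 2 * t + 1"
  have qw: "q = 2 * k * w + 1" unfolding qt w_def by (simp add: algebra_simps)
  then have v: "(q - 1) div 2 = k * w" by simp
  interpret square_cosets \<phi> k w
    by unfold_locales (use assms v in \<open>auto simp: w_def\<close>)
  obtain b where "valid_blocks n b" using valid_blocks_exists[of n n] qw assms(3,6) by auto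
  then show ?thesis unfolding v using heffter_dp_of_valid_blocks by blast
qed

end
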